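(* Let $m$ be an integer that is not a cube, let $K = \mathbb{Q}(\omega)$ with $\omega^3 = m$ denote the corresponding pure cubic field, and let $E_m$ denote the elliptic curve $y^2 = x^3 - m$. There is a bijection between the rational points $(x,y) \in E_m(\mathbb{Q})$ and the elements $\alpha \in K^\times$ with $\alpha^2 = a - \omega$ for $a \in \mathbb{Q}^\times$. In fact, if $\alpha = r + s\omega + t\omega^2$ satisfies $\alpha^2 = a - \omega$, then $(x,y) \in E_m(\mathbb{Q})$ for $x = \frac{s}{t}$ and $y = \frac{1}{t}$. The element $\alpha = 1$ corresponds to the point at infinity on $E_m$, and multiplication by $-1$ in $K^\times$ corresponds to multiplication by $-1$ in $E_m(\mathbb{Q})$. Conversely, an affine point $(x,y) \in E_m(\mathbb{Q})$ corresponds to $$\alpha = -\frac{x^2}{2y} + \frac{x}{y}\,\omega + \frac{1}{y}\,\omega^2 \quad \text{with} \quad \alpha^2 = \frac{x^4 + 8mx}{4y^2} - \omega .$$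
   Context: $E_m(\mathbb{Q})$ denotes the group of rational points of $E_m$, including the point at infinity, which is the neutral element. In $\alpha = r + s\omega + t\omega^2$ the coefficients $r, s, t$ are rational numbers.
   Formalization: As α=1 is not of the form α²=a−ω, it is added to the target; a=0 is allowed (m=−4, point (0,2), α²=−ω), with a∈Q^× matching the points with x≠0 and infinity; compatibility with −1 excludes the point at infinity. *)

theory Defs
  imports "HOL-Algebra.Algebraic_Closure_Type" "HOL-Algebra.Generated_Fields"
begin

text \<open>
  The field \<open>\<rat>(\<omega>)\<close>, as the subfield generated by \<open>\<omega>\<close> inside an ambient
  field of characteristic 0. No particular embedding is chosen.
\<close>
definition rat_adjoin :: "'k::field_char_0 \<Rightarrow> 'k set" where
  "rat_adjoin \<omega> = generate_field ring_of_type_algebra {\<omega>}"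

datatype point = Infinity | Affine rat rat

definition on_curve :: "int \<Rightarrow> point \<Rightarrow> bool" where
  "on_curve m P = (case P of Infinity \<Rightarrow> True | Affine x y \<Rightarrow> y\<^sup>2 = x ^ 3 - of_int m)"

text \<open>
  Chord-and-tangent addition on a curve \<open>y\<^sup>2 = x\<^sup>3 + c\<close>. The constant \<open>c\<close> does not
  enter the formulas. For \<open>x\<^sub>1 = x\<^sub>2\<close> and \<open>y\<^sub>1 \<noteq> -y\<^sub>2\<close>, two points of the curve
  coincide and have \<open>y\<^sub>1 \<noteq> 0\<close>, so the slope is that of the tangent line.
\<close>
fun point_add :: "point \<Rightarrow> point \<Rightarrow> point" where
  "point_add Infinity Q = Q"
| "point_add P Infinity = P"
| "point_add (Affine x1 y1) (Affine x2 y2) =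
    (if x1 = x2 \<and> y1 = - y2 then Infinity
     else let l = (if x1 = x2 then 3 * x1\<^sup>2 / (2 * y1) else (y2 - y1) / (x2 - x1));
              x3 = l\<^sup>2 - x1 - x2
          in Affine x3 (l * (x1 - x3) - y1))"

definition mordell_group :: "int \<Rightarrow> point monoid" where
  "mordell_group m =
     \<lparr>carrier = {P. on_curve m P}, monoid.mult = point_add, one = Infinity\<rparr>"

end

theory Submission
  imports Defs
begin

text \<open>
  Since \<open>1, \<omega>, \<omega>\<^sup>2\<close> is a basis of \<open>\<rat>(\<omega>)\<close>, comparing coefficients in
  \<open>(r + s\<omega> + t\<omega>\<^sup>2)\<^sup>2 = a - \<omega>\<close> yields \<open>s\<^sup>2 + 2rt = 0\<close> and \<open>2rs + mt\<^sup>2 = -1\<close>. So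
  \<open>t \<noteq> 0\<close> and \<open>r\<close> is determined by \<open>s\<close> and \<open>t\<close>, and eliminating \<open>r\<close> leaves the equation of
  the curve in \<open>x = s/t\<close>, \<open>y = 1/t\<close>. Moreover \<open>a = 0\<close> forces \<open>x = 0\<close> or \<open>m = (-x/2)\<^sup>3\<close>, and
  the latter is excluded.
\<close>

text \<open>In lowest terms \<open>a / b\<close>, the cube \<open>b ^ 3\<close> divides
  \<open>a ^ 3\<close>, so \<open>b\<close> divides \<open>a\<close> and coprimality forces
  \<open>b = 1\<close>. This carries the hypothesis on \<open>m\<close> over from integer to
  rational cubes.\<close>

lemma int_cube_if_rat_cube:
  fixes m :: int and q :: rat
  assumes "q ^ 3 = of_int m"
  shows "\<exists>n. m = n ^ 3"
proof -
  obtain a b where q: "quotient_of q = (a, b)" by fastforce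
  have b: "b > 0" and cop: "coprime a b" and qe: "q = of_int a / of_int b"
    using q quotient_of_denom_pos quotient_of_coprime quotient_of_div by blast+
  have "(of_int (a ^ 3) :: rat) = of_int (m * b ^ 3)"
    using assms b unfolding qe by (simp add: field_simps)
  hence eq: "a ^ 3 = m * b ^ 3" unfolding of_int_eq_iff .
  hence "b ^ 3 dvd a ^ 3" by simp
  hence "b dvd a" by (simp add: pow_divides_pow_iff)
  hence "is_unit b" using cop coprime_absorb_right by blast
  hence "b = 1" using b by simp
  with eq show ?thesis by auto
qed

section \<open>Closure of the generated subfield under the ambient field operations\<close>

lemma ring_of_type_algebra_simps [simp]:
  "carrier ring_of_type_algebra = (UNIV :: 'k::field set)"
  "x \<otimes>\<^bsub>ring_of_type_algebra\<^esub> y = (x * y :: 'k)"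
  "\<one>\<^bsub>ring_of_type_algebra\<^esub> = (1 :: 'k)"
  "\<zero>\<^bsub>ring_of_type_algebra\<^esub> = (0 :: 'k)"
  "x \<oplus>\<^bsub>ring_of_type_algebra\<^esub> y = (x + y :: 'k)"
  by (simp_all add: ring_of_type_algebra_def)

lemma a_inv_ring_of_type_algebra [simp]:
  "\<ominus>\<^bsub>ring_of_type_algebra\<^esub> x = (- x :: 'k::field)"
proof -
  interpret field "ring_of_type_algebra :: 'k ring" by (rule field_from_type_algebra)
  show ?thesis by (rule minus_equality) simp_all
qed

lemma inv_ring_of_type_algebra [simp]:
  assumes "x \<noteq> 0"
  shows "inv\<^bsub>ring_of_type_algebra\<^esub> x = (inverse x :: 'k::field)"
proof -
  interpret field "ring_of_type_algebra :: 'k ring" by (rule field_from_type_algebra)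
  show ?thesis by (rule comm_inv_char) (use assms in simp_all)
qed

lemma rat_adjoin_gen: "\<omega> \<in> rat_adjoin \<omega>"
  unfolding rat_adjoin_def by (simp add: generate_field.incl)

lemma rat_adjoin_one: "1 \<in> rat_adjoin \<omega>"
  using generate_field.one[of ring_of_type_algebra "{\<omega>}"] by (simp add: rat_adjoin_def)

lemma rat_adjoin_uminus: "x \<in> rat_adjoin \<omega> \<Longrightarrow> - x \<in> rat_adjoin \<omega>"
  using generate_field.a_inv[of x ring_of_type_algebra "{\<omega>}"] by (simp add: rat_adjoin_def)

lemma rat_adjoin_add: "x \<in> rat_adjoin \<omega> \<Longrightarrow> y \<in> rat_adjoin \<omega> \<Longrightarrow> x + y \<in> rat_adjoin \<omega>"
  using generate_field.eng_add[of x ring_of_type_algebra "{\<omega>}" y] by (simp add: rat_adjoin_def)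

lemma rat_adjoin_mult: "x \<in> rat_adjoin \<omega> \<Longrightarrow> y \<in> rat_adjoin \<omega> \<Longrightarrow> x * y \<in> rat_adjoin \<omega>"
  using generate_field.eng_mult[of x ring_of_type_algebra "{\<omega>}" y] by (simp add: rat_adjoin_def)

lemma rat_adjoin_inverse: "x \<in> rat_adjoin \<omega> \<Longrightarrow> x \<noteq> 0 \<Longrightarrow> inverse x \<in> rat_adjoin \<omega>"
  using generate_field.m_inv[of x ring_of_type_algebra "{\<omega>}"] by (simp add: rat_adjoin_def)

lemma rat_adjoin_zero: "0 \<in> rat_adjoin \<omega>"
  using rat_adjoin_add[OF rat_adjoin_one rat_adjoin_uminus[OF rat_adjoin_one], of \<omega>] by simp

lemma rat_adjoin_of_int: "of_int n \<in> rat_adjoin \<omega>"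
proof -
  have "of_nat k \<in> rat_adjoin \<omega>" for k
    by (induction k) (simp_all add: rat_adjoin_zero rat_adjoin_one rat_adjoin_add)
  thus ?thesis by (cases n rule: int_cases2) (auto intro: rat_adjoin_uminus)
qed

lemma rat_adjoin_of_rat: "of_rat q \<in> rat_adjoin \<omega>"
proof (cases q)
  case (Fract a b)
  thus ?thesis
    by (simp add: of_rat_rat divide_inverse rat_adjoin_mult rat_adjoin_inverse rat_adjoin_of_int)
qed

section \<open>Coordinates with respect to the powers 1, \<omega>, \<omega> squared\<close>

definition cubic_elt :: "'k::field_char_0 \<Rightarrow> rat \<Rightarrow> rat \<Rightarrow> rat \<Rightarrow> 'k" where
  "cubic_elt \<omega> r s t = of_rat r + of_rat s * \<omega> + of_rat t * \<omega>\<^sup>2"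

lemma uminus_cubic_elt: "- cubic_elt \<omega> r s t = cubic_elt \<omega> (-r) (-s) (-t)"
  by (simp add: cubic_elt_def of_rat_minus)

lemma add_cubic_elt:
  "cubic_elt \<omega> r s t + cubic_elt \<omega> r' s' t' = cubic_elt \<omega> (r + r') (s + s') (t + t')"
  by (simp add: cubic_elt_def of_rat_add algebra_simps)

lemma diff_cubic_elt:
  "cubic_elt \<omega> r s t - cubic_elt \<omega> r' s' t' = cubic_elt \<omega> (r - r') (s - s') (t - t')"
  by (simp add: cubic_elt_def of_rat_diff algebra_simps)

text \<open>Only the first branch of the addition law yields \<open>Infinity\<close>. This pins down
  inverses without associativity of the addition.\<close>

lemma point_add_eq_Infinity_iff:
  "point_add (Affine x y) Q = Infinity \<longleftrightarrow> Q = Affine x (- y)"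
  by (cases Q) (auto simp: Let_def)

locale pure_cubic =
  fixes m :: int and \<omega> :: "'k::field_char_0"
  assumes not_cube: "\<nexists>n::int. m = n ^ 3"
    and omega: "\<omega> ^ 3 = of_int m"
begin

lemma rat_not_cube: "q ^ 3 \<noteq> (of_int m :: rat)"
  using int_cube_if_rat_cube not_cube by blast

lemma omega_irrational: "\<omega> \<noteq> of_rat q"
proof
  assume "\<omega> = of_rat q"
  with omega have "(of_rat (q ^ 3) :: 'k) = of_rat (of_int m)"
    by (simp add: of_rat_power)
  thus False using rat_not_cube by (simp only: of_rat_eq_iff)
qed

lemma mult_cubic_elt:
  "cubic_elt \<omega> r s t * cubic_elt \<omega> r' s' t' =
    cubic_elt \<omega> (r * r' + of_int m * (s * t' + t * s'))
      (r * s' + s * r' + of_int m * t * t') (r * t' + s * s' + t * r')"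
proof -
  \<comment> \<open>Writing \<open>m\<close> as \<open>\<omega> ^ 3\<close> turns the claim into a
    polynomial identity in \<omega>.\<close>
  have w: "of_rat (of_int m) = \<omega> ^ 3" using omega by simp
  show ?thesis
    unfolding cubic_elt_def of_rat_add of_rat_mult w
    by (simp add: algebra_simps power2_eq_square power3_eq_cube)
qed

text \<open>Linear independence is proved by hand: a relation of degree 1 makes \<omega> rational,
  and one of degree 2 makes \<open>m\<close> a rational cube.\<close>

lemma cubic_elt_eq_0_iff: "cubic_elt \<omega> r s t = 0 \<longleftrightarrow> r = 0 \<and> s = 0 \<and> t = 0"
proof
  assume z: "cubic_elt \<omega> r s t = 0"
  have lin: "u = 0" if "of_rat u * \<omega> + of_rat v = 0" for u v
  proof (rule ccontr)
    assume "u \<noteq> 0"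
    with that have "\<omega> = of_rat (- v / u)"
      by (simp add: of_rat_divide of_rat_minus field_simps eq_neg_iff_add_eq_0)
    thus False using omega_irrational by blast
  qed
  have t: "t = 0"
  proof (rule ccontr)
    assume t: "t \<noteq> 0"
    \<comment> \<open>Solving for the square of \<omega> and multiplying by \<omega> gives a second
      expression for \<open>m\<close>, again linear in \<omega>. The degree 1 case then yields
      \<open>q = - (p\<^sup>2)\<close> and \<open>p * q = m\<close>, so \<open>m\<close> is the cube
      of \<open>- p\<close>.\<close>
    define p q where "p = - s / t" and "q = - r / t"
    have w2: "\<omega>\<^sup>2 = of_rat p * \<omega> + of_rat q"
      using z t unfolding p_def q_def cubic_elt_def
      by (simp add: of_rat_divide of_rat_minus field_simps eq_neg_iff_add_eq_0)
    have "of_int m = \<omega> * \<omega>\<^sup>2" using omega by (simp add: power3_eq_cube power2_eq_square mult.assoc)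
    also have "\<dots> = of_rat p * \<omega>\<^sup>2 + of_rat q * \<omega>"
      by (subst w2) (simp add: algebra_simps power2_eq_square)
    also have "\<dots> = of_rat (p\<^sup>2 + q) * \<omega> + of_rat (p * q)"
      unfolding w2 by (simp add: algebra_simps of_rat_add of_rat_mult power2_eq_square)
    finally have e: "of_rat (p\<^sup>2 + q) * \<omega> + of_rat (p * q - of_int m) = 0"
      by (simp add: of_rat_diff)
    have pq: "p\<^sup>2 + q = 0" using lin[OF e] .
    with e have "p * q = of_int m" by simp
    moreover have "q = - (p\<^sup>2)" using pq by (simp add: eq_neg_iff_add_eq_0 add.commute)
    ultimately have "(- p) ^ 3 = of_int m" by (simp add: power2_eq_square power3_eq_cube)
    thus False using rat_not_cube by blast
  qed
  with z have "of_rat s * \<omega> + of_rat r = 0" by (simp add: cubic_elt_def add.commute)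
  with lin have "s = 0" by blast
  with z t show "r = 0 \<and> s = 0 \<and> t = 0" by (simp add: cubic_elt_def)
qed (simp add: cubic_elt_def)

lemma cubic_elt_eq_iff:
  "cubic_elt \<omega> r s t = cubic_elt \<omega> r' s' t' \<longleftrightarrow> r = r' \<and> s = s' \<and> t = t'"
  using cubic_elt_eq_0_iff[of "r - r'" "s - s'" "t - t'"]
  by (simp flip: diff_cubic_elt)

text \<open>Supplies the inversion case when the generated field is identified with the span of the
  three powers. Zero is covered since its inverse is zero by convention.\<close>

lemma inverse_cubic_elt: "\<exists>r' s' t'. inverse (cubic_elt \<omega> r s t) = cubic_elt \<omega> r' s' t'"
proof (cases "r = 0 \<and> s = 0 \<and> t = 0")
  case True
  thus ?thesis by (metis cubic_elt_eq_0_iff inverse_zero)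
next
  case False
  \<comment> \<open>the norm of the element, and the product \<open>c\<close> of its two other conjugates\<close>
  define n where "n = r ^ 3 + of_int m * s ^ 3 + (of_int m)\<^sup>2 * t ^ 3 - 3 * of_int m * r * s * t"
  define c where "c = cubic_elt \<omega> (r\<^sup>2 - of_int m * s * t) (of_int m * t\<^sup>2 - r * s) (s\<^sup>2 - r * t)"
  have prod: "cubic_elt \<omega> r s t * c = of_rat n"
    unfolding c_def mult_cubic_elt
    by (simp add: n_def cubic_elt_def algebra_simps power2_eq_square power3_eq_cube)
  \<comment> \<open>The norm is nonzero because both factors are. If \<open>c\<close> vanished, then
    either \<open>t = 0\<close>, which forces \<open>r = s = 0\<close>, or \<open>s / t\<close>
    would be a rational cube root of \<open>m\<close>.\<close>
  have "c \<noteq> 0"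
  proof
    assume "c = 0"
    hence e: "r\<^sup>2 = of_int m * s * t" "of_int m * t\<^sup>2 = r * s" "s\<^sup>2 = r * t"
      unfolding c_def cubic_elt_eq_0_iff by auto
    show False
    proof (cases "t = 0")
      case True
      with e False show False by simp
    next
      case t: False
      have "s ^ 3 = s * s\<^sup>2" by (simp add: power3_eq_cube power2_eq_square)
      also have "\<dots> = t * (r * s)" using e(3) by simp
      also have "\<dots> = of_int m * t ^ 3"
        by (simp flip: e(2) add: power3_eq_cube power2_eq_square)
      finally have "s ^ 3 = of_int m * t ^ 3" .
      hence "(s / t) ^ 3 = of_int m" using t by (simp add: power_divide)
      thus False using rat_not_cube by blast
    qed
  qed
  moreover have "cubic_elt \<omega> r s t \<noteq> 0" using False by (simp add: cubic_elt_eq_0_iff)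
  ultimately have "(of_rat n :: 'k) \<noteq> 0" using prod by (metis mult_eq_0_iff)
  hence "inverse (cubic_elt \<omega> r s t) = cubic_elt \<omega> (1 / n) 0 0 * c"
    using prod \<open>cubic_elt \<omega> r s t \<noteq> 0\<close>
    by (simp add: cubic_elt_def[of _ "1 / n"] of_rat_divide field_simps)
  thus ?thesis unfolding c_def mult_cubic_elt by blast
qed

text \<open>The span contains 1 and \<omega> and is closed under every rule of field generation;
  conversely the subfield contains the rationals and \<omega>.\<close>

lemma rat_adjoin_eq: "rat_adjoin \<omega> = {cubic_elt \<omega> r s t | r s t. True}" (is "_ = ?B")
proof (intro equalityI subsetI)
  let ?R = "ring_of_type_algebra :: 'k ring"
  have one: "1 = cubic_elt \<omega> 1 0 0" and w: "\<omega> = cubic_elt \<omega> 0 1 0"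
    by (simp_all add: cubic_elt_def)
  fix x assume "x \<in> rat_adjoin \<omega>"
  hence "x \<in> generate_field ?R {\<omega>}" by (simp add: rat_adjoin_def)
  thus "x \<in> ?B"
  proof induction
    case one
    show ?case using \<open>1 = cubic_elt \<omega> 1 0 0\<close> by auto
  next
    case (incl h)
    thus ?case using w by blast
  next
    case (a_inv h)
    thus ?case using uminus_cubic_elt by force
  next
    case (m_inv h)
    thus ?case using inverse_cubic_elt by force
  next
    case (eng_add h1 h2)
    thus ?case using add_cubic_elt by force
  next
    case (eng_mult h1 h2)
    thus ?case using mult_cubic_elt by force
  qed
next
  fix x assume "x \<in> ?B"
  thus "x \<in> rat_adjoin \<omega>"
    by (auto simp: cubic_elt_def power2_eq_square
        intro!: rat_adjoin_add rat_adjoin_mult rat_adjoin_of_rat rat_adjoin_gen)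
qed

section \<open>Square roots of \<open>a - \<omega>\<close> and points of the curve\<close>

lemma cubic_elt_square:
  "(cubic_elt \<omega> r s t)\<^sup>2 = of_rat a - \<omega> \<longleftrightarrow>
    a = r\<^sup>2 + 2 * of_int m * s * t \<and> 2 * r * s + of_int m * t\<^sup>2 = -1 \<and> s\<^sup>2 + 2 * r * t = 0"
proof -
  have a: "of_rat a - \<omega> = cubic_elt \<omega> a (-1) 0" by (simp add: cubic_elt_def of_rat_minus)
  show ?thesis
    unfolding a power2_eq_square mult_cubic_elt cubic_elt_eq_iff
    by (auto simp: algebra_simps)
qed

text \<open>A point with \<open>y = 0\<close> would exhibit \<open>m\<close> as the cube of
  \<open>x\<close>.\<close>

lemma on_curve_y_nonzero:
  assumes "on_curve m (Affine x y)"
  shows "y \<noteq> 0"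
  using assms rat_not_cube[of x] by (auto simp: on_curve_def)

lemma Affine_if_square:
  assumes "(cubic_elt \<omega> r s t)\<^sup>2 = of_rat a - \<omega>"
  shows "t \<noteq> 0" "on_curve m (Affine (s / t) (1 / t))" "r = - ((s / t)\<^sup>2 / (2 * (1 / t)))"
proof -
  have e: "2 * r * s + of_int m * t\<^sup>2 = -1" "s\<^sup>2 + 2 * r * t = 0"
    using assms unfolding cubic_elt_square by auto
  \<comment> \<open>If \<open>t = 0\<close>, the second equation gives \<open>s = 0\<close>, and the
    first becomes \<open>0 = -1\<close>.\<close>
  show t: "t \<noteq> 0" using e by auto
  \<comment> \<open>Elimination of \<open>r\<close>: one factor \<open>s\<^sup>2\<close> becomes
    \<open>- (2 * r * t)\<close>, and the product \<open>r * s\<close> that appears is known from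
    the other equation.\<close>
  have "s ^ 3 = s * s\<^sup>2" by (simp add: power3_eq_cube power2_eq_square)
  also have "s\<^sup>2 = - (2 * r * t)" using e(2) by (simp add: eq_neg_iff_add_eq_0)
  also have "s * - (2 * r * t) = t * - (2 * r * s)" by simp
  also have "- (2 * r * s) = 1 + of_int m * t\<^sup>2" using e(1) by simp
  finally have "t = s ^ 3 - of_int m * t ^ 3"
    by (simp add: algebra_simps power2_eq_square power3_eq_cube)
  thus "on_curve m (Affine (s / t) (1 / t))"
    using t by (simp add: on_curve_def field_simps power2_eq_square power3_eq_cube)
  show "r = - ((s / t)\<^sup>2 / (2 * (1 / t)))"
    using t e(2) by (simp add: field_simps power2_eq_square)
qed

text \<open>The coefficients solve \<open>s / t = x\<close> and \<open>1 / t = y\<close>, with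
  \<open>r = - s\<^sup>2 / (2 * t)\<close>. The value 1 at \<open>Infinity\<close> is a convention:
  1 is not a square root of any \<open>a - \<omega>\<close> with rational \<open>a\<close>, which is
  why 1 is inserted into the target sets.\<close>

fun point_elt :: "point \<Rightarrow> 'k" where
  "point_elt Infinity = 1"
| "point_elt (Affine x y) = cubic_elt \<omega> (- (x\<^sup>2 / (2 * y))) (x / y) (1 / y)"

lemma point_elt_square:
  assumes "on_curve m (Affine x y)"
  shows "(point_elt (Affine x y))\<^sup>2 = of_rat ((x ^ 4 + 8 * of_int m * x) / (4 * y\<^sup>2)) - \<omega>"
proof -
  have y: "y \<noteq> 0" using on_curve_y_nonzero assms .
  \<comment> \<open>Eliminating \<open>m\<close> leaves identities of rational functions in
    \<open>x\<close> and \<open>y\<close>.\<close>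
  have e: "of_int m = x ^ 3 - y\<^sup>2" using assms by (simp add: on_curve_def)
  show ?thesis
    unfolding point_elt.simps cubic_elt_square e using y
    by (simp add: field_simps power2_eq_square power3_eq_cube power4_eq_xxxx)
qed

lemma zero_if_point_elt_square:
  assumes "on_curve m (Affine x y)" "(point_elt (Affine x y))\<^sup>2 = of_rat 0 - \<omega>"
  shows "x = 0"
proof (rule ccontr)
  assume x: "x \<noteq> 0"
  have "(of_rat ((x ^ 4 + 8 * of_int m * x) / (4 * y\<^sup>2)) :: 'k) = of_rat 0"
    using assms point_elt_square by simp
  hence "(x ^ 4 + 8 * of_int m * x) / (4 * y\<^sup>2) = 0" unfolding of_rat_eq_iff .
  hence "x * (x ^ 3 + 8 * of_int m) = 0"
    using on_curve_y_nonzero[OF assms(1)] by (simp add: algebra_simps power3_eq_cube power4_eq_xxxx)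
  hence "(- x / 2) ^ 3 = of_int m" using x by (simp add: power3_eq_cube)
  thus False using rat_not_cube by blast
qed

text \<open>The coefficient \<open>1 / y\<close> of the square of \<omega> is nonzero, whereas that
  of 1 is zero.\<close>

lemma point_elt_neq_1:
  assumes "on_curve m (Affine x y)"
  shows "point_elt (Affine x y) \<noteq> 1"
proof -
  have "1 = cubic_elt \<omega> 1 0 0" by (simp add: cubic_elt_def)
  thus ?thesis
    using on_curve_y_nonzero[OF assms] by (metis cubic_elt_eq_iff divide_eq_0_iff one_neq_zero point_elt.simps(2))
qed

text \<open>For affine points, the last coefficient determines \<open>y\<close>, and then the middle
  one determines \<open>x\<close>.\<close>

lemma inj_on_point_elt: "inj_on point_elt {P. on_curve m P}"
proof (rule inj_onI; clarify)
  fix P Q assume PQ: "on_curve m P" "on_curve m Q" "point_elt P = point_elt Q"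
  show "P = Q"
  proof (cases P)
    case Infinity
    with PQ show ?thesis by (cases Q) (auto dest: point_elt_neq_1 simp del: point_elt.simps(2))
  next
    case P: (Affine x y)
    with PQ point_elt_neq_1 obtain u v where Q: "Q = Affine u v"
      by (metis point.exhaust point_elt.simps(1))
    have "y \<noteq> 0" "v \<noteq> 0" using PQ P Q on_curve_y_nonzero by auto
    with PQ P Q show ?thesis by (auto simp: cubic_elt_eq_iff)
  qed
qed

lemma inv_Affine:
  assumes "on_curve m (Affine x y)"
  shows "inv\<^bsub>mordell_group m\<^esub> (Affine x y) = Affine x (- y)"
proof -
  have "on_curve m (Affine x (- y))" using assms by (simp add: on_curve_def)
  thus ?thesis unfolding m_inv_def mordell_group_def
    by (auto simp: point_add_eq_Infinity_iff)
qed

text \<open>The predicate \<open>P\<close> on \<open>a\<close> allows one argument for both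
  bijections: all rational \<open>a\<close> with all points, and nonzero \<open>a\<close> with the
  points that have \<open>x = 0\<close> removed.\<close>

lemma bij_betw_point_elt:
  assumes A: "\<And>x y. on_curve m (Affine x y) \<Longrightarrow>
      Affine x y \<in> A \<longleftrightarrow> (\<exists>a. P a \<and> (point_elt (Affine x y))\<^sup>2 = of_rat a - \<omega>)"
    and "Infinity \<in> A" "A \<subseteq> {P. on_curve m P}"
  shows "bij_betw point_elt A
    (insert 1 {\<alpha> \<in> rat_adjoin \<omega> - {0}. \<exists>a::rat. P a \<and> \<alpha>\<^sup>2 = of_rat a - \<omega>})"
  (is "bij_betw _ _ ?B")
proof (rule bij_betw_imageI)
  show "inj_on point_elt A" using inj_on_point_elt assms(3) inj_on_subset by blast
  show "point_elt ` A = ?B"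
  proof (intro equalityI subsetI)
    fix \<alpha> assume "\<alpha> \<in> point_elt ` A"
    then obtain R where R: "\<alpha> = point_elt R" "R \<in> A" by blast
    show "\<alpha> \<in> ?B"
    proof (cases R)
      case Infinity
      with R show ?thesis by simp
    next
      case (Affine x y)
      moreover from this R assms(3) have "on_curve m (Affine x y)" by blast
      moreover from this have "\<alpha> \<noteq> 0"
        using R Affine on_curve_y_nonzero by (simp add: cubic_elt_eq_0_iff)
      moreover have "\<alpha> \<in> rat_adjoin \<omega>" using R Affine by (auto simp: rat_adjoin_eq)
      ultimately show ?thesis using A R by blast
    qed
  next
    fix \<alpha> assume "\<alpha> \<in> ?B"
    then consider "\<alpha> = 1" | r s t a where "\<alpha> = cubic_elt \<omega> r s t" "P a" "\<alpha>\<^sup>2 = of_rat a - \<omega>"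
      unfolding rat_adjoin_eq by blast
    thus "\<alpha> \<in> point_elt ` A"
    proof cases
      case 1
      thus ?thesis using assms(2) by (metis image_eqI point_elt.simps(1))
    next
      case 2
      note sq = Affine_if_square[OF 2(3)[unfolded 2(1)]]
      have "\<alpha> = point_elt (Affine (s / t) (1 / t))"
        using 2(1) sq(1,3) by simp
      thus ?thesis using A[OF sq(2)] 2 by blast
    qed
  qed
qed

end

theorem theorem1:
  fixes m :: int and \<omega> :: "'k::field_char_0"
  assumes not_cube: "\<not> (\<exists>n::int. m = n ^ 3)"
    and omega: "\<omega> ^ 3 = of_int m"
  shows "\<exists>f :: point \<Rightarrow> 'k.
    bij_betw f (carrier (mordell_group m))
      (insert 1 {\<alpha> \<in> rat_adjoin \<omega> - {0}. \<exists>a::rat. \<alpha>\<^sup>2 = of_rat a - \<omega>}) \<and>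
    bij_betw f (carrier (mordell_group m) - range (Affine 0))
      (insert 1 {\<alpha> \<in> rat_adjoin \<omega> - {0}. \<exists>a::rat. a \<noteq> 0 \<and> \<alpha>\<^sup>2 = of_rat a - \<omega>}) \<and>
    (\<forall>r s t a :: rat.
      (of_rat r + of_rat s * \<omega> + of_rat t * \<omega>\<^sup>2)\<^sup>2 = of_rat a - \<omega> \<longrightarrow>
        t \<noteq> 0 \<and>
        Affine (s / t) (1 / t) \<in> carrier (mordell_group m) \<and>
        f (Affine (s / t) (1 / t)) = of_rat r + of_rat s * \<omega> + of_rat t * \<omega>\<^sup>2) \<and>
    f \<one>\<^bsub>mordell_group m\<^esub> = 1 \<and>
    (\<forall>P \<in> carrier (mordell_group m). P \<noteq> \<one>\<^bsub>mordell_group m\<^esub> \<longrightarrow>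
        f (inv\<^bsub>mordell_group m\<^esub> P) = - f P) \<and>
    (\<forall>x y :: rat. Affine x y \<in> carrier (mordell_group m) \<longrightarrow>
        y \<noteq> 0 \<and>
        f (Affine x y) =
          of_rat (- (x\<^sup>2 / (2 * y))) + of_rat (x / y) * \<omega> + of_rat (1 / y) * \<omega>\<^sup>2 \<and>
        (f (Affine x y))\<^sup>2 = of_rat ((x ^ 4 + 8 * of_int m * x) / (4 * y\<^sup>2)) - \<omega>)"
proof -
  interpret pure_cubic m \<omega> by standard (use not_cube omega in auto)
  have carrier: "carrier (mordell_group m) = {P. on_curve m P}"
    and one: "\<one>\<^bsub>mordell_group m\<^esub> = Infinity"
    by (simp_all add: mordell_group_def)
  have inf: "on_curve m Infinity" by (simp add: on_curve_def)
  show ?thesis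
  proof (intro exI[of _ point_elt] conjI allI impI ballI)
    show "bij_betw point_elt (carrier (mordell_group m))
      (insert 1 {\<alpha> \<in> rat_adjoin \<omega> - {0}. \<exists>a::rat. \<alpha>\<^sup>2 = of_rat a - \<omega>})"
      using bij_betw_point_elt[of "{P. on_curve m P}" "\<lambda>_. True"] point_elt_square inf
      unfolding carrier by fastforce
    \<comment> \<open>The points to be removed are those whose square is \<open>- \<omega>\<close>.
      As \<open>a\<close> is determined by the square, no nonzero \<open>a\<close> can serve for
      them.\<close>
    have "x = 0 \<longleftrightarrow> \<not> (\<exists>a. a \<noteq> 0 \<and> (point_elt (Affine x y))\<^sup>2 = of_rat a - \<omega>)"
      if "on_curve m (Affine x y)" for x y
    proof
      assume "x = 0"
      moreover from this have "(point_elt (Affine x y))\<^sup>2 = of_rat 0 - \<omega>"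
        using point_elt_square[OF that] by simp
      ultimately show "\<not> (\<exists>a. a \<noteq> 0 \<and> (point_elt (Affine x y))\<^sup>2 = of_rat a - \<omega>)"
        by (metis diff_add_cancel of_rat_eq_iff)
    next
      assume "\<not> (\<exists>a. a \<noteq> 0 \<and> (point_elt (Affine x y))\<^sup>2 = of_rat a - \<omega>)"
      thus "x = 0" using point_elt_square[OF that] zero_if_point_elt_square[OF that] by metis
    qed
    thus "bij_betw point_elt (carrier (mordell_group m) - range (Affine 0))
      (insert 1 {\<alpha> \<in> rat_adjoin \<omega> - {0}. \<exists>a::rat. a \<noteq> 0 \<and> \<alpha>\<^sup>2 = of_rat a - \<omega>})"
      unfolding carrier by (intro bij_betw_point_elt) (auto simp: inf simp del: point_elt.simps)
  next
    fix r s t a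
    assume "(of_rat r + of_rat s * \<omega> + of_rat t * \<omega>\<^sup>2)\<^sup>2 = of_rat a - \<omega>"
    note sq = Affine_if_square[OF this[folded cubic_elt_def]]
    show "t \<noteq> 0" "Affine (s / t) (1 / t) \<in> carrier (mordell_group m)"
      using sq carrier by auto
    show "point_elt (Affine (s / t) (1 / t)) = of_rat r + of_rat s * \<omega> + of_rat t * \<omega>\<^sup>2"
      using sq(1,3) by (simp flip: cubic_elt_def)
  next
    show "point_elt \<one>\<^bsub>mordell_group m\<^esub> = 1" by (simp add: one)
  next
    \<comment> \<open>Inversion changes the sign of \<open>y\<close>, and all three coefficients are
      odd in \<open>y\<close>. \<open>Infinity\<close> must be left out: it is its own inverse but
      is sent to 1.\<close>
    fix P assume "P \<in> carrier (mordell_group m)" "P \<noteq> \<one>\<^bsub>mordell_group m\<^esub>"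
    thus "point_elt (inv\<^bsub>mordell_group m\<^esub> P) = - point_elt P"
      by (cases P) (auto simp: carrier one inv_Affine uminus_cubic_elt)
  next
    fix x y assume "Affine x y \<in> carrier (mordell_group m)"
    hence "on_curve m (Affine x y)" by (simp add: carrier)
    thus "y \<noteq> 0"
      "(point_elt (Affine x y))\<^sup>2 = of_rat ((x ^ 4 + 8 * of_int m * x) / (4 * y\<^sup>2)) - \<omega>"
      using on_curve_y_nonzero point_elt_square by blast+
    show "point_elt (Affine x y) =
        of_rat (- (x\<^sup>2 / (2 * y))) + of_rat (x / y) * \<omega> + of_rat (1 / y) * \<omega>\<^sup>2"
      by (simp add: cubic_elt_def)
  qed
qed

end
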